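(* Let $\chi$ be a weight function and $\varphi=\varphi_\chi$ its transform. Let $n\ge 1$ be an integer and assume that, as $|x|\to\infty$, $$\varphi(x)=\frac{g_0(x)}{x^n}+o\!\left(\frac1{x^n}\right),\qquad \varphi'(x)=\frac{g_1(x)}{x^n}+o\!\left(\frac1{x^n}\right),\qquad \varphi''(x)=\frac{g_2(x)}{x^n}+o\!\left(\frac1{x^n}\right),$$ where $g_0,g_1,g_2:\mathbb{R}\to\mathbb{R}$ are bounded on $\mathbb{R}$. Let $d\ge1$, $\nu=(\nu_1,\dots,\nu_d)\in\mathbb{R}^d$, $K=\mathbb{Z}^d\setminus\{(1,0,\dots,0)\}$, and let $$f(t)=e^{i\nu_1t}+\sum_{k\in K}a_k e^{i\langle k,\nu\rangle t},\qquad a_k\in\mathbb{C},$$ be a quasiperiodic function on $\mathbb{R}$. For $k\in K$ put $\Omega_k=\langle k,\nu\rangle-\nu_1$, and assume that $\sum_{k\in K}\left|\frac{a_k}{\Omega_k^p}\right|$ is convergent for $p=0$, $p=1$ and $p=n$. For $T>0$ let $\nu_1^T$ be the frequency map approximation of $\nu_1$, i.e. a value of $\sigma$ at which $|\langle f(t),e^{i\sigma t}\rangle_T^\chi|$ is maximum in a fixed, sufficiently small neighborhood of $\nu_1$ (as made precise in the context). Then, for $T\to+\infty$, $$\nu_1-\nu_1^T=\frac{-1}{T\,\varphi''(0)}\sum_{k\in K}\Re(a_k)\,\varphi'(\Omega_kT)+O\!\left(\frac1{T^{2n+1}}\right).$$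
   Context: A weight function is a nonnegative, even, $C^\infty$ function $\chi$ on $[-1,1]$ such that $\frac12\int_{-1}^1\chi(t)\,dt=1$. For $T>0$, $$\langle f(t),g(t)\rangle_T^\chi=\frac1{2T}\int_{-T}^T f(t)\,\overline{g(t)}\,\chi(t/T)\,dt .$$ The transform of $\chi$ is the $C^\infty$ function on $\mathbb{R}$ defined by $\varphi_\chi(x)=\langle e^{ixt},1\rangle_1^\chi=\frac12\int_{-1}^1e^{ixt}\chi(t)\,dt$ (it is real valued and even, because $\chi$ is even). Here $\langle k,\nu\rangle=\sum_jk_j\nu_j$. The convergence hypothesis for $p\geq 1$ includes that $\Omega_k\ne0$ whenever $a_k\neq0$; terms with $a_k=0$ are read as $0$. Frequency map approximation $\nu_1^T$: the value of $\sigma$ for which $|\langle f(t),e^{i\sigma t}\rangle_T^\chi|$ is maximum in a neighborhood of $\nu_1$. Precisely: there is $\delta_0>0$ depending on $f$ such that for every fixed $\delta\in(0,\delta_0]$ (independent of $T$), $\nu_1^T$ denotes any point of $[\nu_1-\delta,\nu_1+\delta]$ at which $\sigma\mapsto|\langle f(t),e^{i\sigma t}\rangle_T^\chi|$ attains its maximum over that interval; the conclusion is asserted for each such $\delta$ and any such choice of $\nu_1^T$. *)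

theory Defs
  imports "HOL-Analysis.Analysis" "HOL-Library.Landau_Symbols"
begin

text \<open>Derivatives at the end points of the interval are one-sided.\<close>

definition smooth_on_interval :: "real \<Rightarrow> real \<Rightarrow> (real \<Rightarrow> real) \<Rightarrow> bool" where
  "smooth_on_interval a b f \<longleftrightarrow>
     (\<exists>D :: nat \<Rightarrow> real \<Rightarrow> real. D 0 = f \<and>
        (\<forall>m. \<forall>t\<in>{a..b}. (D m has_real_derivative D (Suc m) t) (at t within {a..b})))"

text \<open>Only the values of a weight function on \<open>[-1, 1]\<close> matter.\<close>

definition weight_function :: "(real \<Rightarrow> real) \<Rightarrow> bool" where
  "weight_function chi \<longleftrightarrow>
     smooth_on_interval (- 1) 1 chi \<and>
     (\<forall>t\<in>{- 1..1}. 0 \<le> chi t) \<and>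
     (\<forall>t\<in>{- 1..1}. chi (- t) = chi t) \<and>
     1 / 2 * integral {- 1..1} chi = 1"

definition weighted_inner ::
    "(real \<Rightarrow> real) \<Rightarrow> real \<Rightarrow> (real \<Rightarrow> complex) \<Rightarrow> (real \<Rightarrow> complex) \<Rightarrow> complex" where
  "weighted_inner chi T f g =
     1 / of_real (2 * T) * integral {- T..T} (\<lambda>t. f t * cnj (g t) * of_real (chi (t / T)))"

text \<open>Taking the real part loses nothing: see \<open>weight_transform_eq\<close> below.\<close>

definition weight_transform :: "(real \<Rightarrow> real) \<Rightarrow> real \<Rightarrow> real" where
  "weight_transform chi x = Re (weighted_inner chi 1 (\<lambda>t. cis (x * t)) (\<lambda>_. 1))"

lemma weight_transform_eq:
  assumes "weight_function chi"
  shows "complex_of_real (weight_transform chi x) = weighted_inner chi 1 (\<lambda>t. cis (x * t)) (\<lambda>_. 1)"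
proof -
  let ?h = "\<lambda>t. cis (x * t) * complex_of_real (chi t)"
  obtain D :: "nat \<Rightarrow> real \<Rightarrow> real" where D0: "D 0 = chi"
    and D: "\<And>m t. t \<in> {- 1..1} \<Longrightarrow> (D m has_real_derivative D (Suc m) t) (at t within {- 1..1})"
    using assms unfolding weight_function_def smooth_on_interval_def by blast
  have "continuous_on {- 1..1} chi"
    using D[of _ 0] unfolding D0 by (meson DERIV_continuous_on)
  then have "continuous_on {- 1..1} ?h"
    unfolding cis_conv_exp by (intro continuous_intros)
  then have "?h integrable_on {- 1..1}"
    by (rule integrable_continuous_interval)
  then have Im_eq: "Im (integral {- 1..1} ?h) = integral {- 1..1} (\<lambda>t. sin (x * t) * chi t)"
    using integral_linear[OF _ bounded_linear_Im, of ?h] by (simp add: o_def)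
  have "integral {- 1..1} (\<lambda>t. sin (x * t) * chi t)
      = integral {- 1..1} (\<lambda>t. sin (x * (- t)) * chi (- t))"
    by (rule Henstock_Kurzweil_Integration.integral_reflect_real[of 1 "- 1" "\<lambda>t. sin (x * t) * chi t", symmetric, unfolded minus_minus])
  also have "\<dots> = integral {- 1..1} (\<lambda>t. - (sin (x * t) * chi t))"
    using assms by (intro integral_cong) (auto simp: weight_function_def)
  finally have "integral {- 1..1} (\<lambda>t. sin (x * t) * chi t) = 0"
    by simp
  with Im_eq have "Im (integral {- 1..1} ?h) = 0"
    by simp
  then show ?thesis
    by (simp add: weight_transform_def weighted_inner_def complex_eq_iff)
qed

definition freq :: "real^'d \<Rightarrow> int^'d \<Rightarrow> real" where
  "freq \<nu> k = (\<Sum>i\<in>UNIV. of_int (k $ i) * \<nu> $ i)"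

text \<open>
  The coordinates are labelled by a finite type, and \<open>j\<close> is the label playing the role of
  the first coordinate, so \<open>axis j 1\<close> is \<open>(1, 0, \<dots>, 0)\<close>.
\<close>

definition other_indices :: "'d \<Rightarrow> (int^'d) set" where
  "other_indices j = - {axis j 1}"

definition freq_gap :: "real^'d \<Rightarrow> 'd \<Rightarrow> int^'d \<Rightarrow> real" where
  "freq_gap \<nu> j k = freq \<nu> k - \<nu> $ j"

definition quasiperiodic :: "real^'d \<Rightarrow> 'd \<Rightarrow> (int^'d \<Rightarrow> complex) \<Rightarrow> real \<Rightarrow> complex" where
  "quasiperiodic \<nu> j a t =
     cis (\<nu> $ j * t) + (\<Sum>\<^sub>\<infinity>k\<in>other_indices j. a k * cis (freq \<nu> k * t))"

text \<open>Terms with \<open>a k = 0\<close> contribute 0 even if the gap vanishes, since \<open>0 / 0 = 0\<close>.\<close>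

definition gap_summable :: "real^'d \<Rightarrow> 'd \<Rightarrow> (int^'d \<Rightarrow> complex) \<Rightarrow> nat \<Rightarrow> bool" where
  "gap_summable \<nu> j a p \<longleftrightarrow>
     (\<lambda>k. cmod (a k / of_real (freq_gap \<nu> j k ^ p))) summable_on other_indices j"

text \<open>\<open>s\<close> maximises the modulus over the closed \<open>\<delta>\<close>-neighbourhood of \<open>\<mu>\<close>; it need not be unique.\<close>

definition frequency_map_approx ::
    "(real \<Rightarrow> real) \<Rightarrow> (real \<Rightarrow> complex) \<Rightarrow> real \<Rightarrow> real \<Rightarrow> real \<Rightarrow> real \<Rightarrow> bool" where
  "frequency_map_approx chi f \<mu> \<delta> T s \<longleftrightarrow>
     is_arg_max (\<lambda>\<sigma>. cmod (weighted_inner chi T f (\<lambda>t. cis (\<sigma> * t)))) (\<lambda>\<sigma>. \<sigma> \<in> {\<mu> - \<delta>..\<mu> + \<delta>}) s"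

end

theory Submission
  imports Defs
begin

text \<open>
  Write \<open>\<phi>\<close> for the transform of the weight and substitute \<open>x = (\<sigma> - \<nu>\<^sub>1) T\<close>. Integrating the
  exponential sum term by term turns the inner product with \<open>cis (\<sigma> t)\<close> into the profile
  \<open>F(x) = \<phi>(x) + h(x)\<close> with \<open>h(x) = \<Sum>\<^sub>k a\<^sub>k \<phi>(\<Omega>\<^sub>k T - x)\<close>
  (lemma \<open>weighted_inner_exponential_sum\<close>), so the question is where \<open>\<bar>F\<bar>\<close> is maximal for
  \<open>\<bar>x\<bar> \<le> \<delta> T\<close>. The modulus of the main term \<open>\<phi>\<close> has its strict global maximum at
  0, where \<open>\<phi>(0) = 1\<close> and \<open>\<phi>''(0) < 0\<close>, because \<open>\<phi>\<close> is the mean of \<open>cos (x t)\<close> against a probability density.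

  On a bounded range of \<open>x\<close> the perturbation \<open>h\<close> and its derivative \<open>- \<Sum>\<^sub>k a\<^sub>k \<phi>'(\<Omega>\<^sub>k T - x)\<close> are of
  size \<open>T\<^sup>-\<^sup>n\<close>: the decay of \<open>\<phi>\<close> and its derivatives is stable under bounded shifts of the
  argument, and this holds also where \<open>\<Omega>\<^sub>k T\<close> is small, so that gaps accumulating at 0 do no harm
  once \<open>\<Sum>\<^sub>k \<bar>a\<^sub>k / \<Omega>\<^sub>k\<^sup>n\<bar>\<close> converges (lemmas \<open>shifted_decay\<close> and \<open>norm_weighted_sum_le\<close>).

  The maximum cannot escape from \<open>\<bar>x\<bar> < 1\<close> (lemma \<open>eventually_maximum_near_0\<close>). On a fixed compact
  range away from 0 this is the strictness of the maximum of \<open>\<bar>\<phi>\<bar>\<close>. For large \<open>\<bar>x\<bar> \<le> \<delta> T\<close>, where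
  \<open>\<phi>(x)\<close> is small, a term of \<open>h\<close> can be large only if \<open>\<bar>\<Omega>\<^sub>k\<bar> \<le> 2 \<delta>\<close>, and these terms sum to at
  most \<open>2 \<delta> \<Sum>\<^sub>k \<bar>a\<^sub>k / \<Omega>\<^sub>k\<bar>\<close>. Making this at most \<open>1/4\<close> determines \<open>\<delta>\<^sub>0\<close> from \<open>f\<close> alone,
  independently of the weight.

  The maximum is then an interior critical point of \<open>\<bar>F\<bar>\<^sup>2\<close>, so \<open>Re (F' (x) * cnj (F x)) = 0\<close>.
  As \<open>F\<close> is within \<open>O(T\<^sup>-\<^sup>n)\<close> of the real number \<open>\<phi>(x) \<ge> 1/2\<close>, and \<open>Im (F' x)\<close> is \<open>O(T\<^sup>-\<^sup>n)\<close>
  too, this gives \<open>Re (F' x) = O(T\<^sup>-\<^sup>2\<^sup>n)\<close>. Hence \<open>\<phi>'(x) = O(T\<^sup>-\<^sup>n)\<close>, which forces \<open>x = O(T\<^sup>-\<^sup>n)\<close>, and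
  then replacing \<open>\<phi>'(x)\<close> by \<open>\<phi>''(0) x\<close> and \<open>h'(x)\<close> by \<open>h'(0)\<close> costs only \<open>O(T\<^sup>-\<^sup>2\<^sup>n)\<close> again
  (lemma \<open>critical_point_expansion\<close>). Dividing by \<open>T \<phi>''(0)\<close> gives the theorem.
\<close>

section \<open>Means against a weight and the transform\<close>

lemma abs_sin_minus_self_le: "\<bar>sin y - y\<bar> \<le> y^2 / 2" for y :: real
  using Maclaurin_sin_bound[of y 2] by (simp add: numeral_2_eq_2 sin_coeff_def)

locale weight =
  fixes chi :: "real \<Rightarrow> real"
  assumes weight: "weight_function chi"
begin

text \<open>
  Integration against the probability measure with density \<open>chi / 2\<close> on \<open>[-1, 1]\<close>.
\<close>
definition mean :: "(real \<Rightarrow> real) \<Rightarrow> real" where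
  "mean g = 1 / 2 * integral {-1..1} (\<lambda>t. g t * chi t)"

definition phi :: "real \<Rightarrow> real" where
  "phi x = mean (\<lambda>t. cos (x * t))"

definition phi' :: "real \<Rightarrow> real" where
  "phi' x = mean (\<lambda>t. - t * sin (x * t))"

definition phi'' :: "real \<Rightarrow> real" where
  "phi'' x = mean (\<lambda>t. - (t^2) * cos (x * t))"

lemma chi_nonneg: "t \<in> {-1..1} \<Longrightarrow> 0 \<le> chi t"
  using weight by (simp add: weight_function_def)

lemma continuous_on_chi: "continuous_on {-1..1} chi"
proof -
  obtain D :: "nat \<Rightarrow> real \<Rightarrow> real" where "D 0 = chi"
    and "\<And>m t. t \<in> {- 1..1} \<Longrightarrow> (D m has_real_derivative D (Suc m) t) (at t within {- 1..1})"
    using weight unfolding weight_function_def smooth_on_interval_def by blast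
  then show ?thesis
    by (intro DERIV_continuous_on[of _ _ "D 1"]) (metis One_nat_def)
qed

lemma mean_integrable:
  assumes "continuous_on {-1..1} g"
  shows "(\<lambda>t. g t * chi t) integrable_on {-1..1}"
  using assms continuous_on_chi by (intro integrable_continuous_interval continuous_on_mult)

lemma mean_const: "mean (\<lambda>_. c) = c"
  using weight by (simp add: mean_def weight_function_def)

lemma mean_mult_left: "mean (\<lambda>t. c * g t) = c * mean g"
  by (simp add: mean_def mult.assoc)

lemma mean_minus: "mean (\<lambda>t. - g t) = - mean g"
  using mean_mult_left[of "-1" g] by simp

lemma mean_add:
  assumes "continuous_on {-1..1} f" "continuous_on {-1..1} g"
  shows "mean (\<lambda>t. f t + g t) = mean f + mean g"
  using integral_add[OF mean_integrable[OF assms(1)] mean_integrable[OF assms(2)]]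
  by (simp add: mean_def algebra_simps)

lemma mean_diff:
  assumes "continuous_on {-1..1} f" "continuous_on {-1..1} g"
  shows "mean (\<lambda>t. f t - g t) = mean f - mean g"
  using integral_diff[OF mean_integrable[OF assms(1)] mean_integrable[OF assms(2)]]
  by (simp add: mean_def algebra_simps)

lemma mean_mono:
  assumes "continuous_on {-1..1} f" "continuous_on {-1..1} g"
    and "\<And>t. t \<in> {-1..1} \<Longrightarrow> f t \<le> g t"
  shows "mean f \<le> mean g"
proof -
  have "integral {-1..1} (\<lambda>t. f t * chi t) \<le> integral {-1..1} (\<lambda>t. g t * chi t)"
    by (intro integral_le mean_integrable assms mult_right_mono chi_nonneg)
  then show ?thesis
    by (simp add: mean_def)
qed

lemma abs_mean_le:
  assumes cont: "continuous_on {-1..1} g" and le: "\<And>t. t \<in> {-1..1} \<Longrightarrow> \<bar>g t\<bar> \<le> b"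
  shows "\<bar>mean g\<bar> \<le> b"
proof -
  have "g t \<le> b" "- b \<le> g t" if "t \<in> {-1..1}" for t
    using le[OF that] by linarith+
  then have "mean g \<le> mean (\<lambda>_. b)" "mean (\<lambda>_. - b) \<le> mean g"
    using cont continuous_on_const by (blast intro: mean_mono)+
  then show ?thesis
    unfolding mean_const by linarith
qed

text \<open>
  If the mean of a nonnegative \<open>g\<close> vanished, then \<open>chi\<close> would vanish off the zeros of \<open>g\<close>, which
  form a null set, contradicting that it has total mass 2.
\<close>
lemma mean_pos:
  assumes cont: "continuous_on {-1..1} g" and nonneg: "\<And>t. t \<in> {-1..1} \<Longrightarrow> 0 \<le> g t"
    and null: "countable {t. g t = 0}"
  shows "0 < mean g"
proof -
  have cont': "continuous_on {-1..1} (\<lambda>t. g t * chi t)"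
    using cont continuous_on_chi by (rule continuous_on_mult)
  have "integral {-1..1} (\<lambda>t. g t * chi t) \<noteq> 0"
  proof
    assume "integral {-1..1} (\<lambda>t. g t * chi t) = 0"
    then have "\<forall>t\<in>{-1..1}. g t * chi t = 0"
      using integral_eq_0_iff[OF cont'] nonneg chi_nonneg by simp
    then have "chi t = 0" if "t \<in> {-1..1} - {t. g t = 0}" for t
      using that by auto
    moreover have "negligible {t. g t = 0}"
      unfolding negligible_iff_null_sets
      by (rule null_sets_completionI[OF countable_imp_null_set_lborel[OF null]])
    ultimately have "integral {-1..1} chi = integral {-1..1} (\<lambda>_ :: real. 0)"
      by (intro integral_spike[of "{t. g t = 0}"]) simp_all
    then show False
      using weight by (simp add: weight_function_def)
  qed
  moreover have "0 \<le> integral {-1..1} (\<lambda>t. g t * chi t)"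
    by (intro integral_nonneg mean_integrable cont mult_nonneg_nonneg nonneg chi_nonneg)
  ultimately show ?thesis
    by (simp add: mean_def)
qed

lemma weight_transform_eq_phi: "weight_transform chi = phi"
proof
  fix x
  have "(\<lambda>t. cis (x * t) * of_real (chi t)) integrable_on {-1..1}"
    unfolding cis_conv_exp by (intro integrable_continuous_interval continuous_intros continuous_on_chi)
  from integral_linear[OF this bounded_linear_Re] show "weight_transform chi x = phi x"
    by (simp add: weight_transform_def weighted_inner_def phi_def mean_def o_def)
qed

lemma phi_0: "phi 0 = 1"
  by (simp add: phi_def mean_const)

lemma phi_even: "phi (- x) = phi x"
  by (simp add: phi_def)

text \<open>Differentiation under the integral sign.\<close>
lemma has_derivative_mean:
  assumes "\<And>x t. t \<in> {-1..1} \<Longrightarrow> ((\<lambda>x. g x t) has_real_derivative g' x t) (at x)"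
    and "\<And>x. continuous_on {-1..1} (g x)"
    and cont: "continuous_on UNIV (\<lambda>(x, t). g' x t)"
  shows "((\<lambda>x. mean (g x)) has_real_derivative mean (g' x)) (at x)"
proof -
  have "continuous_on (UNIV \<times> {-1..1}) (\<lambda>z. chi (snd z))"
    by (rule continuous_on_compose2[OF continuous_on_chi continuous_on_snd]) auto
  then have "continuous_on (UNIV \<times> cbox (-1) 1) (\<lambda>(x, t). g' x t * chi t)"
    unfolding case_prod_beta
    using continuous_on_subset[OF cont[unfolded case_prod_beta] subset_UNIV]
    by (intro continuous_on_mult) (auto simp: o_def)
  then have "((\<lambda>x. integral (cbox (-1) 1) (\<lambda>t. g x t * chi t)) has_real_derivative
      integral (cbox (-1) 1) (\<lambda>t. g' x t * chi t)) (at x within UNIV)"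
    using assms(1,2) mean_integrable
    by (intro leibniz_rule_field_derivative DERIV_cmult_right) auto
  then show ?thesis
    unfolding mean_def cbox_interval by (intro DERIV_cmult) simp
qed

lemma phi_has_derivative: "(phi has_real_derivative phi' x) (at x)"
  unfolding phi_def[abs_def] phi'_def
proof (rule has_derivative_mean)
  show "((\<lambda>x. cos (x * t)) has_real_derivative - t * sin (x * t)) (at x)" for x t :: real
    by (rule derivative_eq_intros refl | simp)+
  show "continuous_on {-1..1} (\<lambda>t. cos (x * t))" for x :: real
    by (intro continuous_intros)
  show "continuous_on UNIV (\<lambda>(x, t :: real). - t * sin (x * t))"
    unfolding case_prod_beta by (intro continuous_intros)
qed

lemma phi'_has_derivative: "(phi' has_real_derivative phi'' x) (at x)"
  unfolding phi'_def[abs_def] phi''_def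
proof (rule has_derivative_mean)
  show "((\<lambda>x. - t * sin (x * t)) has_real_derivative - (t^2) * cos (x * t)) (at x)" for x t :: real
    by (rule derivative_eq_intros refl | simp add: power2_eq_square)+
  show "continuous_on {-1..1} (\<lambda>t. - t * sin (x * t))" for x :: real
    by (intro continuous_intros)
  show "continuous_on UNIV (\<lambda>(x, t :: real). - (t^2) * cos (x * t))"
    unfolding case_prod_beta by (intro continuous_intros)
qed

lemma deriv_phi: "deriv phi = phi'"
  using phi_has_derivative by (intro ext DERIV_imp_deriv)

lemma deriv_phi': "deriv phi' = phi''"
  using phi'_has_derivative by (intro ext DERIV_imp_deriv)

lemma abs_phi_le_1: "\<bar>phi x\<bar> \<le> 1"
  unfolding phi_def by (intro abs_mean_le continuous_intros) simp

lemma abs_phi'_le_1: "\<bar>phi' x\<bar> \<le> 1"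
  unfolding phi'_def
proof (rule abs_mean_le)
  show "continuous_on {-1..1} (\<lambda>t. - t * sin (x * t))"
    by (intro continuous_intros)
  show "\<bar>- t * sin (x * t)\<bar> \<le> 1" if "t \<in> {-1..1}" for t
    using that mult_mono[of "\<bar>t\<bar>" 1 "\<bar>sin (x * t)\<bar>" 1] by (simp add: abs_mult abs_le_iff)
qed

lemma abs_phi''_le_1: "\<bar>phi'' x\<bar> \<le> 1"
  unfolding phi''_def
proof (rule abs_mean_le)
  show "continuous_on {-1..1} (\<lambda>t. - (t^2) * cos (x * t))"
    by (intro continuous_intros)
  show "\<bar>- (t^2) * cos (x * t)\<bar> \<le> 1" if "t \<in> {-1..1}" for t
    using that mult_mono[of "t^2" 1 "\<bar>cos (x * t)\<bar>" 1] by (simp add: abs_mult abs_square_le_1 abs_le_iff)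
qed

lemma phi''_0_neg: "phi'' 0 < 0"
proof -
  have "0 < mean (\<lambda>t. t^2)"
    by (intro mean_pos continuous_intros) auto
  then show ?thesis
    using mean_minus[of "\<lambda>t. t^2"] by (simp add: phi''_def)
qed

text \<open>
  Equality would force \<open>cos (x t) = 1\<close>, or \<open>cos (x t) = - 1\<close>, at almost every \<open>t\<close> where the
  weight is positive; either can happen only at the zeros of \<open>sin (x t)\<close>, which are countably many.
\<close>
lemma abs_phi_less_1:
  assumes "x \<noteq> 0"
  shows "\<bar>phi x\<bar> < 1"
proof -
  have "countable (range (\<lambda>i::int. of_int i * pi / x))"
    by simp
  then have null: "countable {t. sin (x * t) = 0}"
    by (rule countable_subset[rotated])
       (use assms in \<open>auto simp: sin_zero_iff_int2 field_simps\<close>)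
  have "0 < mean (\<lambda>t. 1 - cos (x * t))" "0 < mean (\<lambda>t. 1 + cos (x * t))"
  proof -
    have "{t. 1 - cos (x * t) = 0} \<subseteq> {t. sin (x * t) = 0}"
         "{t. 1 + cos (x * t) = 0} \<subseteq> {t. sin (x * t) = 0}"
    proof -
      have "sin y = 0" if "(cos y)\<^sup>2 = 1" for y :: real
        using that sin_cos_squared_add[of y] by simp
      moreover have "(cos y)\<^sup>2 = 1" if "1 - cos y = 0 \<or> 1 + cos y = 0" for y :: real
        using that by (auto simp: power2_eq_1_iff)
      ultimately show "{t. 1 - cos (x * t) = 0} \<subseteq> {t. sin (x * t) = 0}"
         "{t. 1 + cos (x * t) = 0} \<subseteq> {t. sin (x * t) = 0}"
        by blast+
    qed
    then have "countable {t. 1 - cos (x * t) = 0}" "countable {t. 1 + cos (x * t) = 0}"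
      using null countable_subset by blast+
    moreover have "0 \<le> 1 + cos y" for y :: real
      using cos_ge_minus_one[of y] by linarith
    ultimately show "0 < mean (\<lambda>t. 1 - cos (x * t))" "0 < mean (\<lambda>t. 1 + cos (x * t))"
      by (intro mean_pos continuous_intros; simp)+
  qed
  then show ?thesis
    by (subst (asm) mean_diff, (intro continuous_intros)+,
        subst (asm) mean_add, (intro continuous_intros)+)
       (simp add: mean_const phi_def abs_less_iff)
qed

text \<open>
  Here \<open>cos y = 1 - 2 (sin (y / 2))\<^sup>2 \<ge> 1 - y\<^sup>2 / 2\<close> is averaged over arguments \<open>y = x t\<close> in \<open>[-1, 1]\<close>.
\<close>
lemma phi_ge_half:
  assumes "\<bar>x\<bar> \<le> 1"
  shows "1 / 2 \<le> phi x"
proof -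
  have "1 / 2 \<le> cos (x * t)" if "t \<in> {-1..1}" for t
  proof -
    have "\<bar>sin (x * t / 2)\<bar> \<le> \<bar>x * t / 2\<bar>"
      by (rule abs_sin_x_le_abs_x)
    also have "\<dots> \<le> 1 / 2"
      using assms that mult_mono[of "\<bar>x\<bar>" 1 "\<bar>t\<bar>" 1] by (simp add: abs_mult abs_le_iff)
    finally have "(sin (x * t / 2))\<^sup>2 \<le> (1 / 2)\<^sup>2"
      by (subst abs_le_square_iff[symmetric]) simp
    then show ?thesis
      using cos_double_sin[of "x * t / 2"] by (simp add: power2_eq_square)
  qed
  then have "mean (\<lambda>_. 1 / 2) \<le> phi x"
    unfolding phi_def by (intro mean_mono continuous_intros) auto
  then show ?thesis
    by (simp add: mean_const)
qed

lemma phi'_linear_approx: "\<bar>phi' x - phi'' 0 * x\<bar> \<le> x^2 / 2"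
proof -
  have "phi'' 0 * x = mean (\<lambda>t. x * (- (t^2) * cos (0 * t)))"
    unfolding phi''_def by (subst mean_mult_left) simp
  then have "phi' x - phi'' 0 * x = mean (\<lambda>t. - t * sin (x * t) - x * (- (t^2) * cos (0 * t)))"
    unfolding phi'_def by (subst mean_diff) (intro continuous_intros refl | simp)+
  also have "\<bar>\<dots>\<bar> \<le> x^2 / 2"
  proof (rule abs_mean_le)
    fix t :: real assume t: "t \<in> {-1..1}"
    have "\<bar>- t * sin (x * t) - x * (- (t^2) * cos (0 * t))\<bar> = \<bar>t\<bar> * \<bar>sin (x * t) - x * t\<bar>"
      by (subst abs_mult[symmetric], subst abs_minus_cancel[symmetric])
         (simp add: algebra_simps power2_eq_square)
    also have "\<dots> \<le> 1 * ((x * t)^2 / 2)"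
      using t by (intro mult_mono abs_sin_minus_self_le) auto
    also have "\<dots> \<le> x^2 / 2"
      using t by (auto simp: power_mult_distrib abs_square_le_1 intro!: mult_left_le)
    finally show "\<bar>- t * sin (x * t) - x * (- (t^2) * cos (0 * t))\<bar> \<le> x^2 / 2" .
  qed (intro continuous_intros)
  finally show ?thesis .
qed

text \<open>
  The mean of \<open>y sin y \<ge> y\<^sup>2 / 2\<close> with \<open>y = x t\<close>, as the mean of \<open>t\<^sup>2\<close> is
  \<open>- phi'' 0\<close>. It turns a bound on \<open>phi' x\<close> into one of the same order on \<open>x\<close>.
\<close>
lemma phi'_lower_bound:
  assumes "\<bar>x\<bar> \<le> 1"
  shows "- phi'' 0 / 2 * \<bar>x\<bar> \<le> \<bar>phi' x\<bar>"
proof -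
  have "x^2 / 2 * t^2 \<le> x * (t * sin (x * t))" if t: "t \<in> {-1..1}" for t
  proof -
    define y where "y = x * t"
    have y: "\<bar>y\<bar> \<le> 1"
      using assms t mult_mono[of "\<bar>x\<bar>" 1 "\<bar>t\<bar>" 1] by (simp add: y_def abs_mult abs_le_iff)
    have "y * (y - sin y) \<le> \<bar>y\<bar> * \<bar>sin y - y\<bar>"
      by (metis abs_ge_self abs_minus_commute abs_mult)
    also have "\<dots> \<le> 1 * (y^2 / 2)"
      using y by (intro mult_mono abs_sin_minus_self_le) auto
    finally show ?thesis
      by (simp add: y_def algebra_simps power2_eq_square)
  qed
  then have "mean (\<lambda>t. x^2 / 2 * t^2) \<le> mean (\<lambda>t. x * (t * sin (x * t)))"
    by (intro mean_mono continuous_intros) auto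
  then have "- phi'' 0 / 2 * x^2 \<le> - (x * phi' x)"
    unfolding mean_mult_left using mean_minus[of "\<lambda>t. t^2"] mean_minus[of "\<lambda>t. t * sin (x * t)"]
    by (simp add: phi''_def phi'_def mult.commute)
  also have "\<dots> \<le> \<bar>x\<bar> * \<bar>phi' x\<bar>"
    by (metis abs_ge_self abs_minus_cancel abs_mult)
  finally have *: "\<bar>x\<bar> * (- phi'' 0 / 2 * \<bar>x\<bar>) \<le> \<bar>x\<bar> * \<bar>phi' x\<bar>"
    by (simp add: power2_eq_square abs_mult[symmetric] algebra_simps)
  show ?thesis
  proof (cases "x = 0")
    case False
    then show ?thesis
      by (intro mult_left_le_imp_le[OF *]) simp
  qed simp
qed

end

section \<open>Majorised sums\<close>

lemma norm_infsum_le_majorant: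
  fixes f :: "'k \<Rightarrow> 'a :: banach"
  assumes "g summable_on I" and "\<And>k. k \<in> I \<Longrightarrow> norm (f k) \<le> g k"
  shows "f summable_on I" and "norm (infsum f I) \<le> infsum g I"
proof -
  have abs: "f abs_summable_on I"
    using assms by (rule Infinite_Sum.abs_summable_on_comparison_test')
  then show sum: "f summable_on I"
    by (rule abs_summable_summable)
  show "norm (infsum f I) \<le> infsum g I"
    using norm_infsum_le[OF has_sum_infsum[OF sum] has_sum_infsum[OF assms(1)]] assms(2) by blast
qed

lemma has_sum_minus:
  fixes f g :: "'k \<Rightarrow> 'a :: real_normed_vector"
  assumes "(f has_sum s) I" "(g has_sum t) I"
  shows "((\<lambda>k. f k - g k) has_sum (s - t)) I"
  using has_sum_add[OF assms(1) has_sum_scaleR[OF assms(2), of "-1"]] by simp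

text \<open>
  Termwise differentiation. A quadratic remainder with summable constants survives the summation,
  so it bounds the remainder of the sum directly.
\<close>
lemma has_vector_derivative_infsum:
  fixes f f' :: "'k \<Rightarrow> real \<Rightarrow> 'a :: banach"
  assumes "\<And>y. (\<lambda>k. f k y) summable_on I" and "\<And>y. (\<lambda>k. f' k y) summable_on I"
    and g: "g summable_on I"
    and taylor: "\<And>k y. k \<in> I \<Longrightarrow> norm (f k y - f k x - (y - x) *\<^sub>R f' k x) \<le> g k * (y - x)^2"
  shows "((\<lambda>y. \<Sum>\<^sub>\<infinity>k\<in>I. f k y) has_vector_derivative (\<Sum>\<^sub>\<infinity>k\<in>I. f' k x)) (at x)"
proof -
  define F where "F y = (\<Sum>\<^sub>\<infinity>k\<in>I. f k y)" for y
  define F' where "F' = (\<Sum>\<^sub>\<infinity>k\<in>I. f' k x)"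
  define G where "G = (\<Sum>\<^sub>\<infinity>k\<in>I. g k)"
  have bound: "norm (F y - F x - (y - x) *\<^sub>R F') \<le> G * (y - x)^2" for y
  proof -
    have "((\<lambda>k. f k y - f k x - (y - x) *\<^sub>R f' k x) has_sum (F y - F x - (y - x) *\<^sub>R F')) I"
      unfolding F_def F'_def
      by (rule has_sum_minus[OF has_sum_minus[OF has_sum_infsum[OF assms(1)] has_sum_infsum[OF assms(1)]]
            has_sum_scaleR[OF has_sum_infsum[OF assms(2)]]])
    then have "F y - F x - (y - x) *\<^sub>R F' = (\<Sum>\<^sub>\<infinity>k\<in>I. f k y - f k x - (y - x) *\<^sub>R f' k x)"
      by (simp add: infsumI)
    also have "norm \<dots> \<le> (\<Sum>\<^sub>\<infinity>k\<in>I. g k * (y - x)^2)"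
      using g taylor by (intro norm_infsum_le_majorant(2) summable_on_cmult_left)
    also have "\<dots> = G * (y - x)^2"
      unfolding G_def by (rule infsum_cmult_left')
    finally show ?thesis .
  qed
  have "((\<lambda>y. inverse (norm (y - x)) *\<^sub>R (F y - F x - (y - x) *\<^sub>R F')) \<longlongrightarrow> 0) (at x)"
  proof (rule Lim_null_comparison)
    show "\<forall>\<^sub>F y in at x. norm (inverse (norm (y - x)) *\<^sub>R (F y - F x - (y - x) *\<^sub>R F')) \<le> \<bar>G\<bar> * \<bar>y - x\<bar>"
    proof (rule always_eventually, rule allI)
      fix y
      show "norm (inverse (norm (y - x)) *\<^sub>R (F y - F x - (y - x) *\<^sub>R F')) \<le> \<bar>G\<bar> * \<bar>y - x\<bar>"
      proof (cases "y = x")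
        case False
        have "norm (F y - F x - (y - x) *\<^sub>R F') \<le> \<bar>G\<bar> * \<bar>y - x\<bar>^2"
          using bound[of y] mult_right_mono[OF abs_ge_self, of "(y - x)^2" G] by (simp only: power2_abs) simp
        then have "inverse \<bar>y - x\<bar> * norm (F y - F x - (y - x) *\<^sub>R F')
            \<le> inverse \<bar>y - x\<bar> * (\<bar>G\<bar> * \<bar>y - x\<bar>^2)"
          by (intro mult_left_mono) auto
        also have "\<dots> = \<bar>G\<bar> * \<bar>y - x\<bar>"
          using False by (simp add: power2_eq_square[of "\<bar>y - x\<bar>"] del: power2_abs abs_mult_self_eq)
        finally show ?thesis
          by simp
      qed simp
    qed
    have "((\<lambda>y. \<bar>G\<bar> * \<bar>y - x\<bar>) \<longlongrightarrow> \<bar>G\<bar> * \<bar>x - x\<bar>) (at x)"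
      by (intro tendsto_intros)
    then show "((\<lambda>y. \<bar>G\<bar> * \<bar>y - x\<bar>) \<longlongrightarrow> 0) (at x)"
      by simp
  qed
  then show ?thesis
    unfolding has_vector_derivative_def has_derivative_at_within
    by (simp add: F_def F'_def bounded_linear_scaleR_left divide_inverse)
qed

section \<open>The inner product of an exponential sum with a pure oscillation\<close>

context weight
begin

lemma weighted_inner_rescale:
  assumes "T > 0"
  shows "weighted_inner chi T f g =
    1 / 2 * integral {-1..1} (\<lambda>u. f (T * u) * cnj (g (T * u)) * of_real (chi u))"
proof -
  have "(\<lambda>t. t / T) ` {- T..T} = {-1..1}"
    using assms image_divide_atLeastAtMost[of T "- T" T] by simp
  with integral_stretch_real[of T "- T" T "\<lambda>t. f t * cnj (g t) * of_real (chi (t / T))"] assms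
  show ?thesis
    by (simp add: weighted_inner_def scaleR_conv_of_real)
qed

lemma has_integral_cis_chi:
  "((\<lambda>u. cis (c * u) * of_real (chi u)) has_integral of_real (2 * phi c)) {-1..1}"
proof -
  have "(\<lambda>u. cis (c * u) * of_real (chi u)) integrable_on {-1..1}"
    unfolding cis_conv_exp by (intro integrable_continuous_interval continuous_intros continuous_on_chi)
  moreover have "integral {-1..1} (\<lambda>u. cis (c * u) * of_real (chi u)) = of_real (2 * phi c)"
    using weight_transform_eq[OF weight, of c] weight_transform_eq_phi
    by (simp add: weighted_inner_def mult.commute)
  ultimately show ?thesis
    by (simp add: has_integral_iff)
qed

text \<open>
  Sum and integral may be exchanged because absolute summability of the coefficients and
  boundedness of the weight make the convergence uniform.
\<close>
lemma has_integral_sum_cis_chi: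
  fixes a :: "'k \<Rightarrow> complex" and c :: "'k \<Rightarrow> real"
  assumes "(\<lambda>k. cmod (a k)) summable_on I"
  shows "((\<lambda>u. (\<Sum>\<^sub>\<infinity>k\<in>I. a k * cis (c k * u)) * of_real (chi u)) has_integral
           2 * (\<Sum>\<^sub>\<infinity>k\<in>I. a k * of_real (phi (c k)))) {-1..1}"
proof -
  obtain b where b: "cmod (of_real (chi u)) \<le> b" if "u \<in> {-1..1}" for u
  proof -
    have "compact (chi ` {-1..1})"
      using continuous_on_chi by (intro compact_continuous_image) auto
    then have "bounded (chi ` {-1..1})"
      by (rule compact_imp_bounded)
    then show ?thesis
      using that by (metis bounded_iff imageI norm_of_real real_norm_def)
  qed
  let ?f = "\<lambda>X u. \<Sum>k\<in>X. a k * cis (c k * u) * of_real (chi u)"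
  let ?g = "\<lambda>u. \<Sum>\<^sub>\<infinity>k\<in>I. a k * cis (c k * u) * of_real (chi u)"
  have unif: "uniform_limit {-1..1} ?f ?g (finite_subsets_at_top I)"
  proof (rule Weierstrass_m_test_general)
    show "(\<lambda>k. cmod (a k) * b) summable_on I"
      using assms by (rule summable_on_cmult_left)
    show "cmod (a k * cis (c k * u) * of_real (chi u)) \<le> cmod (a k) * b" if "u \<in> {-1..1}" for k u
      using mult_left_mono[OF b[OF that], of "cmod (a k)"] by (simp add: norm_mult)
  qed
  have cont: "continuous_on {-1..1} (?f X)" for X
    unfolding cis_conv_exp by (intro continuous_intros continuous_on_chi)
  obtain i J where i: "\<And>X. (?f X has_integral i X) {-1..1}" and J: "(?g has_integral J) {-1..1}"
    and lim: "(i \<longlongrightarrow> J) (finite_subsets_at_top I)"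
    by (rule uniform_limit_integral[OF unif cont finite_subsets_at_top_neq_bot]) (rule that)
  have "i X = (\<Sum>k\<in>X. 2 * (a k * of_real (phi (c k))))" if "finite X" for X
  proof (rule has_integral_unique[OF i])
    have "((\<lambda>u. \<Sum>k\<in>X. a k * (cis (c k * u) * of_real (chi u))) has_integral
        (\<Sum>k\<in>X. a k * of_real (2 * phi (c k)))) {-1..1}"
      using that by (intro has_integral_sum has_integral_mult_right has_integral_cis_chi)
    then show "((\<lambda>u. \<Sum>k\<in>X. a k * cis (c k * u) * of_real (chi u)) has_integral
        (\<Sum>k\<in>X. 2 * (a k * of_real (phi (c k))))) {-1..1}"
      by (simp add: mult.assoc mult.left_commute)
  qed
  then have "((\<lambda>k. 2 * (a k * of_real (phi (c k)))) has_sum J) I"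
    unfolding has_sum_def
    by (intro Lim_transform_eventually[OF lim] eventually_finite_subsets_at_top_weakI) simp
  then have "J = 2 * (\<Sum>\<^sub>\<infinity>k\<in>I. a k * of_real (phi (c k)))"
    unfolding infsum_cmult_right'[symmetric] by (rule infsumI[symmetric])
  with J show ?thesis
    unfolding infsum_cmult_left' by simp
qed

text \<open>
  The inner product only sees the differences of frequencies, on the scale \<open>1 / T\<close>.
\<close>
lemma weighted_inner_exponential_sum:
  fixes a :: "'k \<Rightarrow> complex" and \<omega> :: "'k \<Rightarrow> real"
  assumes sum: "(\<lambda>k. cmod (a k)) summable_on I" and "T > 0"
  shows "weighted_inner chi T (\<lambda>t. cis (\<mu> * t) + (\<Sum>\<^sub>\<infinity>k\<in>I. a k * cis (\<omega> k * t))) (\<lambda>t. cis (\<sigma> * t)) =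
    of_real (phi ((\<mu> - \<sigma>) * T)) + (\<Sum>\<^sub>\<infinity>k\<in>I. a k * of_real (phi ((\<omega> k - \<sigma>) * T)))"
proof -
  have shift: "cis (\<eta> * (T * u)) * cis (- (\<sigma> * (T * u))) = cis ((\<eta> - \<sigma>) * T * u)" for \<eta> u
    by (simp add: cis_mult algebra_simps)
  have integrand: "(cis (\<mu> * (T * u)) + (\<Sum>\<^sub>\<infinity>k\<in>I. a k * cis (\<omega> k * (T * u)))) * cnj (cis (\<sigma> * (T * u)))
      = cis ((\<mu> - \<sigma>) * T * u) + (\<Sum>\<^sub>\<infinity>k\<in>I. a k * cis ((\<omega> k - \<sigma>) * T * u))" for u
    unfolding cis_cnj distrib_right infsum_cmult_left'[symmetric] mult.assoc[of "a _"] shift ..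
  have "((\<lambda>u. (cis ((\<mu> - \<sigma>) * T * u) + (\<Sum>\<^sub>\<infinity>k\<in>I. a k * cis ((\<omega> k - \<sigma>) * T * u))) * of_real (chi u))
      has_integral of_real (2 * phi ((\<mu> - \<sigma>) * T)) +
        2 * (\<Sum>\<^sub>\<infinity>k\<in>I. a k * of_real (phi ((\<omega> k - \<sigma>) * T)))) {-1..1}"
    unfolding distrib_right
    by (intro has_integral_add has_integral_cis_chi has_integral_sum_cis_chi sum)
  from integral_unique[OF this] show ?thesis
    unfolding weighted_inner_rescale[OF \<open>T > 0\<close>] integrand by simp
qed

end

section \<open>Polynomial decay and its stability under bounded shifts\<close>

text \<open>
  Either \<open>\<bar>y\<bar> \<le> 2 \<bar>y - x\<bar>\<close>, and the decay at \<open>y - x\<close> helps, or \<open>\<bar>y\<bar> \<le> 2 R\<close>, and the trivial bound on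
  \<open>psi\<close> is enough. Thus no condition on the size of \<open>y\<close> appears.
\<close>
lemma shifted_decay:
  fixes psi :: "real \<Rightarrow> real"
  assumes "\<bar>psi (y - x)\<bar> \<le> 1" and "\<bar>psi (y - x)\<bar> * \<bar>y - x\<bar> ^ n \<le> C" and "\<bar>x\<bar> \<le> R"
  shows "\<bar>psi (y - x)\<bar> * \<bar>y\<bar> ^ n \<le> 2 ^ n * (C + R ^ n)"
proof -
  have "\<bar>y\<bar> ^ n \<le> (2 * max \<bar>y - x\<bar> R) ^ n"
  proof (rule power_mono)
    show "\<bar>y\<bar> \<le> 2 * max \<bar>y - x\<bar> R"
      using assms(3) abs_triangle_ineq[of "y - x" x, unfolded diff_add_cancel]
      by (simp add: max_def)
  qed simp
  also have "\<dots> \<le> 2 ^ n * (\<bar>y - x\<bar> ^ n + R ^ n)"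
    using assms(3) by (simp add: power_mult_distrib max_def)
  finally have "\<bar>psi (y - x)\<bar> * \<bar>y\<bar> ^ n \<le> \<bar>psi (y - x)\<bar> * (2 ^ n * (\<bar>y - x\<bar> ^ n + R ^ n))"
    by (intro mult_left_mono) auto
  also have "\<dots> = 2 ^ n * (\<bar>psi (y - x)\<bar> * \<bar>y - x\<bar> ^ n + \<bar>psi (y - x)\<bar> * R ^ n)"
    by (simp add: algebra_simps)
  also have "\<dots> \<le> 2 ^ n * (C + 1 * R ^ n)"
    using assms by (intro mult_left_mono add_mono mult_right_mono) auto
  finally show ?thesis
    by simp
qed

lemma far_decay:
  fixes psi :: "real \<Rightarrow> real"
  assumes "\<bar>psi (y - x)\<bar> * \<bar>y - x\<bar> ^ n \<le> C" and "2 * \<bar>x\<bar> \<le> \<bar>y\<bar>"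
  shows "\<bar>psi (y - x)\<bar> * \<bar>y\<bar> ^ n \<le> 2 ^ n * C"
proof -
  have "\<bar>y\<bar> ^ n \<le> (2 * \<bar>y - x\<bar>) ^ n"
  proof (rule power_mono)
    show "\<bar>y\<bar> \<le> 2 * \<bar>y - x\<bar>"
      using assms(2) abs_triangle_ineq[of "y - x" x, unfolded diff_add_cancel] by simp
  qed simp
  then have "\<bar>psi (y - x)\<bar> * \<bar>y\<bar> ^ n \<le> \<bar>psi (y - x)\<bar> * (2 * \<bar>y - x\<bar>) ^ n"
    by (intro mult_left_mono) auto
  also have "\<dots> = 2 ^ n * (\<bar>psi (y - x)\<bar> * \<bar>y - x\<bar> ^ n)"
    by (simp add: power_mult_distrib)
  also have "\<dots> \<le> 2 ^ n * C"
    using assms(1) by (intro mult_left_mono) auto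
  finally show ?thesis .
qed

text \<open>
  The asymptotic formula gives the bound near infinity, and the trivial bound on \<open>psi\<close> gives it on
  the remaining bounded interval.
\<close>
lemma decay_bound_from_asymptotics:
  fixes psi g :: "real \<Rightarrow> real"
  assumes le_1: "\<And>x. \<bar>psi x\<bar> \<le> 1" and "bounded (range g)"
    and small: "(\<lambda>x. psi x - g x / x ^ n) \<in> o[at_infinity](\<lambda>x. 1 / x ^ n)"
  shows "\<exists>C. \<forall>x. \<bar>psi x\<bar> * \<bar>x\<bar> ^ n \<le> C"
proof -
  obtain G where G: "\<And>x. \<bar>g x\<bar> \<le> G"
    using assms(2) by (auto simp: bounded_iff)
  have "\<forall>\<^sub>F x in at_infinity. norm (psi x - g x / x ^ n) \<le> 1 * norm (1 / x ^ n)"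
    using landau_o.smallD[OF small, of 1] by simp
  then obtain b where b: "\<And>x. b \<le> \<bar>x\<bar> \<Longrightarrow> \<bar>psi x - g x / x ^ n\<bar> \<le> \<bar>1 / x ^ n\<bar>"
    unfolding eventually_at_infinity by auto
  have "\<bar>psi x\<bar> * \<bar>x\<bar> ^ n \<le> max (G + 1) (max (\<bar>b\<bar> ^ n) 1)" for x
  proof (cases "b \<le> \<bar>x\<bar> \<and> x \<noteq> 0")
    case True
    have "\<bar>psi x\<bar> \<le> \<bar>g x / x ^ n\<bar> + \<bar>1 / x ^ n\<bar>"
      using b[of x] True by linarith
    then have "\<bar>psi x\<bar> * \<bar>x\<bar> ^ n \<le> \<bar>g x\<bar> + 1"
      using True mult_right_mono[of "\<bar>psi x\<bar>" "\<bar>g x / x ^ n\<bar> + \<bar>1 / x ^ n\<bar>" "\<bar>x\<bar> ^ n"]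
      by (simp add: distrib_right power_abs)
    then show ?thesis
      using G[of x] by linarith
  next
    case False
    then have "\<bar>x\<bar> ^ n \<le> max (\<bar>b\<bar> ^ n) 1"
    proof (cases "x = 0")
      case x: False
      then have "\<bar>x\<bar> ^ n \<le> \<bar>b\<bar> ^ n"
        using False by (intro power_mono) auto
      then show ?thesis
        by linarith
    qed (simp add: power_0_left max.coboundedI2)
    moreover have "\<bar>psi x\<bar> * \<bar>x\<bar> ^ n \<le> 1 * \<bar>x\<bar> ^ n"
      using le_1 by (intro mult_right_mono) auto
    ultimately show ?thesis
      by linarith
  qed
  then show ?thesis
    by blast
qed

section \<open>The rescaled amplitude profile\<close>

text \<open>
  The data of an exponential sum as seen from its leading frequency: amplitudes \<open>a\<close>, frequency
  gaps \<open>\<Omega>\<close>, and a single decay constant \<open>C\<close> for the transform and its two derivatives.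
\<close>
locale perturbed_weight = weight chi for chi :: "real \<Rightarrow> real" +
  fixes I :: "'k set" and a :: "'k \<Rightarrow> complex" and \<Omega> :: "'k \<Rightarrow> real" and n :: nat and C :: real
  assumes gap_nz: "\<And>k. k \<in> I \<Longrightarrow> a k \<noteq> 0 \<Longrightarrow> \<Omega> k \<noteq> 0"
    and summable_0: "(\<lambda>k. cmod (a k)) summable_on I"
    and summable_1: "(\<lambda>k. cmod (a k / of_real (\<Omega> k))) summable_on I"
    and summable_n: "(\<lambda>k. cmod (a k / of_real (\<Omega> k ^ n))) summable_on I"
    and n_pos: "1 \<le> n"
    and decay: "\<And>x. \<bar>phi x\<bar> * \<bar>x\<bar> ^ n \<le> C" "\<And>x. \<bar>phi' x\<bar> * \<bar>x\<bar> ^ n \<le> C"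
      "\<And>x. \<bar>phi'' x\<bar> * \<bar>x\<bar> ^ n \<le> C"
begin

text \<open>
  The contribution of the other frequencies at the rescaled offset \<open>x = (\<sigma> - \<nu>\<^sub>1) T\<close>. The derivative
  of \<open>noise T\<close> is \<open>- noise' T\<close>, because the offset enters the argument with a minus sign.
\<close>
definition noise :: "real \<Rightarrow> real \<Rightarrow> complex" where
  "noise T x = (\<Sum>\<^sub>\<infinity>k\<in>I. a k * of_real (phi (\<Omega> k * T - x)))"

definition noise' :: "real \<Rightarrow> real \<Rightarrow> complex" where
  "noise' T x = (\<Sum>\<^sub>\<infinity>k\<in>I. a k * of_real (phi' (\<Omega> k * T - x)))"

definition profile :: "real \<Rightarrow> real \<Rightarrow> complex" where
  "profile T x = of_real (phi x) + noise T x"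

definition gap_sum :: "nat \<Rightarrow> real" where
  "gap_sum p = (\<Sum>\<^sub>\<infinity>k\<in>I. cmod (a k / of_real (\<Omega> k ^ p)))"

lemma C_nonneg: "0 \<le> C"
  using decay(1)[of 0] by (meson abs_ge_zero mult_nonneg_nonneg order_trans zero_le_power)

lemma gap_sum_nonneg: "0 \<le> gap_sum p"
  unfolding gap_sum_def by (rule infsum_nonneg) simp

lemma summable_bounded_coeff:
  assumes "\<And>k. \<bar>p k\<bar> \<le> 1"
  shows "(\<lambda>k. a k * of_real (p k)) summable_on I"
  using summable_0
proof (rule norm_infsum_le_majorant(1))
  show "cmod (a k * of_real (p k)) \<le> cmod (a k)" for k
    using assms[of k] by (simp add: norm_mult mult_left_le)
qed

text \<open>
  This is where a power of \<open>T\<close> is gained: each factor \<open>p k\<close> is traded for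
  \<open>1 / \<bar>\<Omega> k * T\<bar> ^ n\<close>, and the powers of the gaps are absorbed by the summability of
  \<open>a k / \<Omega> k ^ n\<close>.
\<close>
lemma norm_weighted_sum_le:
  assumes "T > 0" and bound: "\<And>k. k \<in> I \<Longrightarrow> \<bar>p k\<bar> * \<bar>\<Omega> k * T\<bar> ^ n \<le> M"
  shows "cmod (\<Sum>\<^sub>\<infinity>k\<in>I. a k * of_real (p k)) \<le> gap_sum n * M / T ^ n"
proof -
  have "cmod (\<Sum>\<^sub>\<infinity>k\<in>I. a k * of_real (p k)) \<le> (\<Sum>\<^sub>\<infinity>k\<in>I. cmod (a k / of_real (\<Omega> k ^ n)) * (M / T ^ n))"
  proof (rule norm_infsum_le_majorant(2))
    show "(\<lambda>k. cmod (a k / of_real (\<Omega> k ^ n)) * (M / T ^ n)) summable_on I"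
      by (intro summable_on_cmult_left summable_n)
    fix k assume k: "k \<in> I"
    show "cmod (a k * of_real (p k)) \<le> cmod (a k / of_real (\<Omega> k ^ n)) * (M / T ^ n)"
    proof (cases "a k = 0")
      case False
      then have pos: "0 < \<bar>\<Omega> k\<bar> ^ n" "0 < T ^ n"
        using gap_nz[OF k] \<open>T > 0\<close> by auto
      have "\<bar>p k\<bar> * (\<bar>\<Omega> k\<bar> ^ n * T ^ n) \<le> M"
        using bound[OF k] \<open>T > 0\<close> by (simp add: abs_mult power_mult_distrib)
      then have "\<bar>p k\<bar> \<le> M / (\<bar>\<Omega> k\<bar> ^ n * T ^ n)"
        using pos by (subst pos_le_divide_eq) auto
      then have "cmod (a k) * \<bar>p k\<bar> \<le> cmod (a k) * (M / (\<bar>\<Omega> k\<bar> ^ n * T ^ n))"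
        by (rule mult_left_mono) simp
      then show ?thesis
        by (simp add: norm_mult norm_divide norm_power)
    qed simp
  qed
  also have "\<dots> = gap_sum n * M / T ^ n"
    unfolding gap_sum_def infsum_cmult_left' by simp
  finally show ?thesis .
qed

lemma noise_le:
  assumes "T > 0" "\<bar>x\<bar> \<le> R"
  shows "cmod (noise T x) \<le> gap_sum n * (2 ^ n * (C + R ^ n)) / T ^ n"
  unfolding noise_def using assms decay(1) abs_phi_le_1
  by (intro norm_weighted_sum_le shifted_decay)

lemma noise'_le:
  assumes "T > 0" "\<bar>x\<bar> \<le> R"
  shows "cmod (noise' T x) \<le> gap_sum n * (2 ^ n * (C + R ^ n)) / T ^ n"
  unfolding noise'_def using assms decay(2) abs_phi'_le_1
  by (intro norm_weighted_sum_le shifted_decay)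

text \<open>
  The mean value theorem, with the intermediate value of \<open>phi''\<close> estimated by \<open>shifted_decay\<close>. The
  difference keeps the factor \<open>\<bar>x\<bar>\<close>, which later contributes another \<open>1 / T ^ n\<close>.
\<close>
lemma phi'_shift_le:
  assumes "\<bar>x\<bar> \<le> 1"
  shows "\<bar>phi' (y - x) - phi' y\<bar> * \<bar>y\<bar> ^ n \<le> \<bar>x\<bar> * (2 ^ n * (C + 1))"
proof (cases "y = 0")
  case True
  then show ?thesis
    using n_pos C_nonneg by (simp add: power_0_left)
next
  case False
  have "\<bar>phi' (y - x) - phi' y\<bar> \<le> 2 ^ n * (C + 1) / \<bar>y\<bar> ^ n * \<bar>(y - x) - y\<bar>"
    unfolding real_norm_def[symmetric]
  proof (rule field_differentiable_bound)
    show "convex (cball y 1)"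
      by simp
    show "y - x \<in> cball y 1" "y \<in> cball y 1"
      using assms by (auto simp: dist_real_def)
    show "(phi' has_field_derivative phi'' z) (at z within cball y 1)" for z
      using phi'_has_derivative by (rule has_field_derivative_at_within)
    show "norm (phi'' z) \<le> 2 ^ n * (C + 1) / norm y ^ n" if "z \<in> cball y 1" for z
    proof -
      have "\<bar>y - z\<bar> \<le> 1"
        using that by (simp add: dist_real_def)
      then have "\<bar>phi'' z\<bar> * \<bar>y\<bar> ^ n \<le> 2 ^ n * (C + 1)"
        using shifted_decay[of phi'' y "y - z" n C 1] decay(3)[of z] abs_phi''_le_1[of z] by simp
      then show ?thesis
        using False by (simp add: pos_le_divide_eq)
    qed
  qed
  then show ?thesis
    using False by (simp add: field_simps)
qed

lemma noise'_lipschitz: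
  assumes "T > 0" "\<bar>x\<bar> \<le> 1"
  shows "cmod (noise' T x - noise' T 0) \<le> gap_sum n * (\<bar>x\<bar> * (2 ^ n * (C + 1))) / T ^ n"
proof -
  have "noise' T x - noise' T 0 =
      (\<Sum>\<^sub>\<infinity>k\<in>I. a k * of_real (phi' (\<Omega> k * T - x) - phi' (\<Omega> k * T)))"
    using has_sum_minus[OF has_sum_infsum has_sum_infsum,
        of "\<lambda>k. a k * of_real (phi' (\<Omega> k * T - x))" I "\<lambda>k. a k * of_real (phi' (\<Omega> k * T - 0))"]
    by (simp add: noise'_def summable_bounded_coeff abs_phi'_le_1 infsumI right_diff_distrib)
  then show ?thesis
    using norm_weighted_sum_le[OF \<open>T > 0\<close>, of "\<lambda>k. phi' (\<Omega> k * T - x) - phi' (\<Omega> k * T)"]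
      phi'_shift_le[OF assms(2)] by simp
qed

lemma phi_taylor: "\<bar>phi (y + h) - phi y - h * phi' y\<bar> \<le> h^2"
proof -
  have "norm ((phi (y + h) - phi' y * (y + h)) - (phi y - phi' y * y)) \<le> \<bar>h\<bar> * norm (y + h - y)"
  proof (rule field_differentiable_bound)
    show "convex (cball y \<bar>h\<bar>)"
      by simp
    show "y + h \<in> cball y \<bar>h\<bar>" "y \<in> cball y \<bar>h\<bar>"
      by (auto simp: dist_real_def)
    show "((\<lambda>z. phi z - phi' y * z) has_field_derivative phi' z - phi' y) (at z within cball y \<bar>h\<bar>)" for z
      by (rule derivative_eq_intros phi_has_derivative[THEN has_field_derivative_at_within] refl | simp)+
    show "norm (phi' z - phi' y) \<le> \<bar>h\<bar>" if "z \<in> cball y \<bar>h\<bar>" for z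
      using field_differentiable_bound[of UNIV phi' phi'' 1 z y] phi'_has_derivative abs_phi''_le_1 that
      by (simp add: dist_real_def abs_minus_commute)
  qed
  then show ?thesis
    by (simp add: algebra_simps power2_eq_square)
qed

lemma profile_has_derivative:
  "(profile T has_vector_derivative (of_real (phi' x) - noise' T x)) (at x)"
proof -
  have "((\<lambda>y. \<Sum>\<^sub>\<infinity>k\<in>I. a k * of_real (phi (\<Omega> k * T - y))) has_vector_derivative
      (\<Sum>\<^sub>\<infinity>k\<in>I. - (a k * of_real (phi' (\<Omega> k * T - x))))) (at x)"
  proof (rule has_vector_derivative_infsum)
    show "(\<lambda>k. a k * of_real (phi (\<Omega> k * T - y))) summable_on I" for y
      by (intro summable_bounded_coeff abs_phi_le_1)
    show "(\<lambda>k. - (a k * of_real (phi' (\<Omega> k * T - y)))) summable_on I" for y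
      by (intro summable_on_uminus[THEN iffD2] summable_bounded_coeff abs_phi'_le_1)
    show "(\<lambda>k. cmod (a k)) summable_on I"
      by (rule summable_0)
    show "cmod (a k * of_real (phi (\<Omega> k * T - y)) - a k * of_real (phi (\<Omega> k * T - x))
        - (y - x) *\<^sub>R - (a k * of_real (phi' (\<Omega> k * T - x)))) \<le> cmod (a k) * (y - x)\<^sup>2" for k y
    proof -
      let ?r = "phi (\<Omega> k * T - y) - phi (\<Omega> k * T - x) - (x - y) * phi' (\<Omega> k * T - x)"
      have "a k * of_real (phi (\<Omega> k * T - y)) - a k * of_real (phi (\<Omega> k * T - x))
          - (y - x) *\<^sub>R - (a k * of_real (phi' (\<Omega> k * T - x))) = a k * of_real ?r"
        by (simp add: scaleR_conv_of_real algebra_simps)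
      moreover have "\<bar>?r\<bar> \<le> (y - x)\<^sup>2"
        using phi_taylor[of "\<Omega> k * T - x" "x - y"] by (simp add: power2_commute)
      ultimately show ?thesis
        by (metis mult_left_mono norm_ge_zero norm_mult norm_of_real)
    qed
  qed
  then have "(noise T has_vector_derivative - noise' T x) (at x)"
    by (simp add: noise_def[abs_def] noise'_def infsum_uminus)
  moreover have "((\<lambda>y. complex_of_real (phi y)) has_vector_derivative of_real (phi' x)) (at x)"
    using phi_has_derivative[of x]
    by (intro has_vector_derivative_of_real) (simp add: has_real_derivative_iff_has_vector_derivative)
  ultimately show ?thesis
    unfolding profile_def[abs_def] using has_vector_derivative_add by fastforce
qed

section \<open>Localisation of the maximum\<close>

lemma phi_eventually_small:
  obtains R where "1 \<le> R" "\<And>x. R \<le> \<bar>x\<bar> \<Longrightarrow> \<bar>phi x\<bar> \<le> 1 / 4"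
proof
  show "1 \<le> max 1 (4 * C)"
    by simp
  show "\<bar>phi x\<bar> \<le> 1 / 4" if x: "max 1 (4 * C) \<le> \<bar>x\<bar>" for x
  proof -
    have "\<bar>x\<bar> ^ 1 \<le> \<bar>x\<bar> ^ n"
      using n_pos x by (intro power_increasing) auto
    then have "\<bar>phi x\<bar> * \<bar>x\<bar> \<le> \<bar>phi x\<bar> * \<bar>x\<bar> ^ n"
      by (intro mult_left_mono) auto
    also have "\<dots> \<le> \<bar>x\<bar> / 4"
      using decay(1)[of x] x by simp
    finally have "\<bar>phi x\<bar> * \<bar>x\<bar> \<le> 1 / 4 * \<bar>x\<bar>"
      by simp
    then show ?thesis
      by (rule mult_right_le_imp_le) (use x in auto)
  qed
qed

lemma phi_middle_bound:
  assumes "1 \<le> R"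
  obtains q where "q < 1" "\<And>x. 1 \<le> \<bar>x\<bar> \<Longrightarrow> \<bar>x\<bar> \<le> R \<Longrightarrow> \<bar>phi x\<bar> \<le> q"
proof -
  have "continuous_on {1..R} (\<lambda>x. \<bar>phi x\<bar>)"
    by (intro continuous_on_rabs DERIV_continuous_on[OF has_field_derivative_at_within[OF phi_has_derivative]])
  then obtain z where z: "z \<in> {1..R}" "\<And>x. x \<in> {1..R} \<Longrightarrow> \<bar>phi x\<bar> \<le> \<bar>phi z\<bar>"
    using continuous_attains_sup[of "{1..R}" "\<lambda>x. \<bar>phi x\<bar>"] assms by auto
  show thesis
  proof
    show "\<bar>phi z\<bar> < 1"
      using z(1) by (intro abs_phi_less_1) auto
    show "\<bar>phi x\<bar> \<le> \<bar>phi z\<bar>" if "1 \<le> \<bar>x\<bar>" "\<bar>x\<bar> \<le> R" for x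
      using z(2)[of "\<bar>x\<bar>"] that phi_even[of x] by (simp add: abs_if split: if_splits)
  qed
qed

text \<open>
  For offsets comparable with \<open>T\<close> the perturbation need not be small, since \<open>x\<close> may come close to
  some \<open>\<Omega> k * T\<close>. This requires \<open>\<bar>\<Omega> k\<bar> \<le> 2 \<delta>\<close>, and then \<open>\<bar>a k\<bar> \<le> 2 \<delta> \<bar>a k / \<Omega> k\<bar>\<close>; for all other \<open>k\<close>
  the point \<open>x\<close> stays in the range of \<open>far_decay\<close>.
\<close>
lemma noise_far_le:
  assumes "T > 0" "0 \<le> \<delta>" "\<bar>x\<bar> \<le> \<delta> * T"
  shows "cmod (noise T x) \<le> 2 * \<delta> * gap_sum 1 + gap_sum n * (2 ^ n * C) / T ^ n"
proof -
  let ?p = "\<lambda>k. phi (\<Omega> k * T - x)"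
  let ?g = "\<lambda>k. cmod (a k / of_real (\<Omega> k ^ 1)) * (2 * \<delta>) + cmod (a k / of_real (\<Omega> k ^ n)) * (2 ^ n * C / T ^ n)"
  have "(?g has_sum gap_sum 1 * (2 * \<delta>) + gap_sum n * (2 ^ n * C / T ^ n)) I"
    unfolding gap_sum_def using summable_1 summable_n
    by (intro has_sum_add has_sum_cmult_left has_sum_infsum) simp_all
  then have sum: "?g summable_on I" "infsum ?g I = gap_sum 1 * (2 * \<delta>) + gap_sum n * (2 ^ n * C / T ^ n)"
    by (auto simp: has_sum_iff)
  have "cmod (noise T x) \<le> infsum ?g I"
    unfolding noise_def
  proof (rule norm_infsum_le_majorant(2)[OF sum(1)])
    fix k assume k: "k \<in> I"
    show "cmod (a k * of_real (?p k)) \<le> ?g k"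
    proof (cases "a k = 0")
      case False
      with gap_nz[OF k] have nz: "\<Omega> k \<noteq> 0"
        by simp
      show ?thesis
      proof (cases "\<bar>\<Omega> k\<bar> \<le> 2 * \<delta>")
        case True
        have "cmod (a k * of_real (?p k)) \<le> cmod (a k)"
          using abs_phi_le_1 by (simp add: norm_mult mult_left_le)
        also have "\<dots> = cmod (a k / of_real (\<Omega> k ^ 1)) * \<bar>\<Omega> k\<bar>"
          using nz by (simp add: norm_divide)
        also have "\<dots> \<le> cmod (a k / of_real (\<Omega> k ^ 1)) * (2 * \<delta>)"
          using True by (rule mult_left_mono) simp
        finally show ?thesis
          using C_nonneg \<open>T > 0\<close> by (intro add_increasing2) auto
      next
        case False
        have "2 * \<bar>x\<bar> \<le> 2 * \<delta> * T"
          using assms(3) by simp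
        also have "\<dots> \<le> \<bar>\<Omega> k * T\<bar>"
          using False \<open>T > 0\<close> by (simp add: abs_mult)
        finally have "\<bar>?p k\<bar> * \<bar>\<Omega> k * T\<bar> ^ n \<le> 2 ^ n * C"
          using decay(1) by (intro far_decay)
        then have "\<bar>?p k\<bar> \<le> 2 ^ n * C / (\<bar>\<Omega> k\<bar> ^ n * T ^ n)"
          using nz \<open>T > 0\<close> by (subst pos_le_divide_eq) (auto simp: abs_mult power_mult_distrib)
        then have "cmod (a k) * \<bar>?p k\<bar> \<le> cmod (a k) * (2 ^ n * C / (\<bar>\<Omega> k\<bar> ^ n * T ^ n))"
          by (rule mult_left_mono) simp
        then have "cmod (a k * of_real (?p k)) \<le> cmod (a k / of_real (\<Omega> k ^ n)) * (2 ^ n * C / T ^ n)"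
          by (simp add: norm_mult norm_divide norm_power)
        then show ?thesis
          using assms(2) by (intro add_increasing) auto
      qed
    qed (use C_nonneg \<open>T > 0\<close> in simp)
  qed
  with sum(2) show ?thesis
    by (simp add: mult.commute)
qed

lemma eventually_const_over_power_less:
  assumes "0 < (e :: real)"
  shows "\<forall>\<^sub>F T in at_top. b / T ^ n < e"
proof -
  have "((\<lambda>T :: real. b / T ^ n) \<longlongrightarrow> 0) at_top"
    using n_pos by (intro tendsto_divide_0[OF tendsto_const] filterlim_at_top_imp_at_infinity
        filterlim_pow_at_top filterlim_ident) auto
  then show ?thesis
    using assms by (rule order_tendstoD(2))
qed

text \<open>
  The value at 0 tends to 1. Outside \<open>\<bar>x\<bar> < 1\<close> the modulus stays below a constant smaller than 1: on a
  compact range by \<open>abs_phi_less_1\<close>, and beyond it because \<open>phi\<close> and the resonant part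
  of the noise are each at most \<open>1 / 4\<close>. The radius \<open>\<delta>\<close> is constrained by the amplitudes and gaps
  only.
\<close>
lemma eventually_maximum_near_0:
  assumes "0 \<le> \<delta>" "8 * \<delta> * gap_sum 1 \<le> 1"
  shows "\<forall>\<^sub>F T in at_top. \<forall>x. \<bar>x\<bar> \<le> \<delta> * T \<longrightarrow> cmod (profile T 0) \<le> cmod (profile T x) \<longrightarrow> \<bar>x\<bar> < 1"
proof -
  obtain R where R: "1 \<le> R" "\<And>x. R \<le> \<bar>x\<bar> \<Longrightarrow> \<bar>phi x\<bar> \<le> 1 / 4"
    using phi_eventually_small by blast
  obtain q where q: "q < 1" "\<And>x. 1 \<le> \<bar>x\<bar> \<Longrightarrow> \<bar>x\<bar> \<le> R \<Longrightarrow> \<bar>phi x\<bar> \<le> q"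
    using phi_middle_bound[OF R(1)] by blast
  define B where "B = gap_sum n * (2 ^ n * (C + R ^ n))"
  have "\<forall>\<^sub>F T in at_top. B / T ^ n < min (1 / 4) ((1 - q) / 2)"
    using q(1) by (intro eventually_const_over_power_less) simp
  then show ?thesis
    using eventually_gt_at_top[of 0]
  proof eventually_elim
    case (elim T)
    show ?case
    proof (intro allI impI, rule ccontr)
      fix x assume x: "\<bar>x\<bar> \<le> \<delta> * T" and le: "cmod (profile T 0) \<le> cmod (profile T x)" and "\<not> \<bar>x\<bar> < 1"
      have "cmod (noise T 0) \<le> B / T ^ n"
        unfolding B_def using elim R(1) by (intro noise_le) auto
      then have lower: "1 - B / T ^ n \<le> cmod (profile T 0)"
        using norm_diff_ineq[of 1 "noise T 0"] by (simp add: profile_def phi_0)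
      have upper: "cmod (profile T x) \<le> \<bar>phi x\<bar> + cmod (noise T x)"
        unfolding profile_def by (metis norm_of_real norm_triangle_ineq)
      show False
      proof (cases "\<bar>x\<bar> \<le> R")
        case True
        then have "cmod (noise T x) \<le> B / T ^ n"
          unfolding B_def using elim by (intro noise_le) auto
        moreover have "\<bar>phi x\<bar> \<le> q"
          using True \<open>\<not> \<bar>x\<bar> < 1\<close> by (intro q(2)) auto
        ultimately show False
          using lower upper le elim(1)[unfolded min_less_iff_conj] by simp
      next
        case False
        have "gap_sum n * (2 ^ n * C) \<le> B"
          unfolding B_def using R(1) gap_sum_nonneg by (intro mult_left_mono) auto
        then have "gap_sum n * (2 ^ n * C) / T ^ n \<le> B / T ^ n"
          using elim by (intro divide_right_mono) auto
        then have "cmod (noise T x) \<le> 1 / 4 + B / T ^ n"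
          using noise_far_le[of T \<delta> x] elim x assms by simp
        moreover have "\<bar>phi x\<bar> \<le> 1 / 4"
          using False by (intro R(2)) auto
        ultimately show False
          using lower upper le elim(1) by linarith
      qed
    qed
  qed
qed

section \<open>Expansion at a critical point\<close>

text \<open>
  The derivative of the squared modulus \<open>cmod (profile T y)\<^sup>2\<close> vanishes, written out in real and
  imaginary parts. The right-hand side is a product of two noise terms, hence of second order.
\<close>
lemma critical_point_equation:
  assumes "d > 0" and "\<And>y. \<bar>y - x\<bar> < d \<Longrightarrow> cmod (profile T y) \<le> cmod (profile T x)"
  shows "(phi' x - Re (noise' T x)) * (phi x + Re (noise T x)) = Im (noise' T x) * Im (noise T x)"
proof -
  let ?P = "profile T" and ?D = "of_real (phi' x) - noise' T x"
  have "((\<lambda>y. Re (?P y)) has_real_derivative Re ?D) (at x)"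
    and "((\<lambda>y. Im (?P y)) has_real_derivative Im ?D) (at x)"
    unfolding has_real_derivative_iff_has_vector_derivative
    by (rule bounded_linear.has_vector_derivative[OF bounded_linear_Re profile_has_derivative]
             bounded_linear.has_vector_derivative[OF bounded_linear_Im profile_has_derivative])+
  from DERIV_add[OF DERIV_power[OF this(1), of 2] DERIV_power[OF this(2), of 2]]
  have "((\<lambda>y. (Re (?P y))\<^sup>2 + (Im (?P y))\<^sup>2) has_real_derivative
      2 * (Re (?P x) * Re ?D + Im (?P x) * Im ?D)) (at x)"
    by (simp add: algebra_simps)
  moreover have "\<forall>y. \<bar>x - y\<bar> < d \<longrightarrow> (Re (?P y))\<^sup>2 + (Im (?P y))\<^sup>2 \<le> (Re (?P x))\<^sup>2 + (Im (?P x))\<^sup>2"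
    unfolding cmod_power2[symmetric] using assms(2) by (auto simp: abs_minus_commute intro!: power_mono)
  ultimately have "2 * (Re (?P x) * Re ?D + Im (?P x) * Im ?D) = 0"
    using assms(1) by (intro DERIV_local_max)
  then show ?thesis
    by (simp add: profile_def algebra_simps)
qed

text \<open>
  The equation is used twice: coarsely, to see that \<open>x\<close> itself is of order \<open>1 / T ^ n\<close>, and
  then with this knowledge, to see that linearising \<open>phi'\<close> and evaluating the noise at 0 instead
  of \<open>x\<close> are errors of order \<open>1 / T ^ (2 * n)\<close>.
\<close>
lemma critical_point_expansion:
  "\<exists>D. \<forall>\<^sub>F T in at_top. \<forall>x. \<bar>x\<bar> < 1 \<longrightarrow>
     (phi' x - Re (noise' T x)) * (phi x + Re (noise T x)) = Im (noise' T x) * Im (noise T x) \<longrightarrow>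
     \<bar>phi'' 0 * x - Re (noise' T 0)\<bar> \<le> D / T ^ (2 * n)"
proof -
  define B where "B = gap_sum n * (2 ^ n * (C + 1))"
  define c where "c = - phi'' 0 / 2"
  define K where "K = 2 * B / c"
  have c: "c > 0"
    using phi''_0_neg by (simp add: c_def)
  have "\<forall>\<^sub>F T in at_top. B / T ^ n < 1 / 4"
    by (intro eventually_const_over_power_less) simp
  then have "\<forall>\<^sub>F T in at_top. \<forall>x. \<bar>x\<bar> < 1 \<longrightarrow>
     (phi' x - Re (noise' T x)) * (phi x + Re (noise T x)) = Im (noise' T x) * Im (noise T x) \<longrightarrow>
     \<bar>phi'' 0 * x - Re (noise' T 0)\<bar> \<le> (K^2 / 2 + 4 * B^2 + K * B) / T ^ (2 * n)"
    using eventually_gt_at_top[of 0]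
  proof eventually_elim
    case (elim T)
    show ?case
    proof (intro allI impI)
      fix x :: real
      assume x: "\<bar>x\<bar> < 1"
        and crit: "(phi' x - Re (noise' T x)) * (phi x + Re (noise T x)) = Im (noise' T x) * Im (noise T x)"
      define e where "e = B / T ^ n"
      have e: "0 \<le> e" "e < 1 / 4"
        using elim gap_sum_nonneg C_nonneg by (auto simp: e_def B_def)
      have noise: "cmod (noise T x) \<le> e" and noise': "cmod (noise' T x) \<le> e"
        using noise_le[of T x 1] noise'_le[of T x 1] elim x by (auto simp: e_def B_def)
      have lip: "cmod (noise' T x - noise' T 0) \<le> \<bar>x\<bar> * e"
        using noise'_lipschitz[of T x] elim x by (simp add: e_def B_def mult_ac)
      have "1 / 4 \<le> phi x + Re (noise T x)"
        using phi_ge_half[of x] x abs_Re_le_cmod[of "noise T x"] noise e by linarith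
      then have "\<bar>phi' x - Re (noise' T x)\<bar> * (1 / 4) \<le> \<bar>phi' x - Re (noise' T x)\<bar> * \<bar>phi x + Re (noise T x)\<bar>"
        by (intro mult_left_mono) auto
      also have "\<dots> = \<bar>Im (noise' T x)\<bar> * \<bar>Im (noise T x)\<bar>"
        using crit by (metis abs_mult)
      also have "\<dots> \<le> e * e"
        using noise noise' abs_Im_le_cmod[of "noise T x"] abs_Im_le_cmod[of "noise' T x"]
        by (intro mult_mono) auto
      finally have first_order: "\<bar>phi' x - Re (noise' T x)\<bar> \<le> 4 * e^2"
        by (simp add: power2_eq_square)
      have "c * \<bar>x\<bar> \<le> \<bar>phi' x\<bar>"
        using phi'_lower_bound[of x] x by (simp add: c_def)
      also have "\<dots> \<le> e + 4 * e^2"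
        using first_order noise' abs_Re_le_cmod[of "noise' T x"] by linarith
      also have "\<dots> \<le> 2 * e"
        using mult_left_mono[of "4 * e" 1 e] e by (simp add: power2_eq_square)
      finally have "\<bar>x\<bar> \<le> 2 * e / c"
        using c by (simp add: pos_le_divide_eq mult.commute)
      then have x_le: "\<bar>x\<bar> \<le> K / T ^ n"
        by (simp add: K_def e_def mult.commute)
      show "\<bar>phi'' 0 * x - Re (noise' T 0)\<bar> \<le> (K^2 / 2 + 4 * B^2 + K * B) / T ^ (2 * n)"
      proof -
        have "\<bar>phi'' 0 * x - Re (noise' T 0)\<bar> \<le> x^2 / 2 + 4 * e^2 + \<bar>x\<bar> * e"
          using phi'_linear_approx[of x] first_order lip abs_Re_le_cmod[of "noise' T x - noise' T 0"]
          unfolding minus_complex.sel by linarith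
        also have "\<dots> \<le> (K / T ^ n)^2 / 2 + 4 * e^2 + K / T ^ n * e"
          using x_le e power_mono[OF x_le, of 2]
          by (intro add_mono mult_right_mono divide_right_mono) auto
        also have "\<dots> = (K^2 / 2 + 4 * B^2 + K * B) / T ^ (2 * n)"
          by (simp add: e_def power_divide add_divide_distrib power_even_eq power2_eq_square)
        finally show ?thesis .
      qed
    qed
  qed
  then show ?thesis
    by blast
qed

end

section \<open>The frequency map approximation\<close>

theorem theorem2:
  fixes \<nu> :: "real^'d" and j :: 'd and a :: "int^'d \<Rightarrow> complex"
  assumes gap_nz: "\<And>k. k \<in> other_indices j \<Longrightarrow> a k \<noteq> 0 \<Longrightarrow> freq_gap \<nu> j k \<noteq> 0"
    and conv_0: "gap_summable \<nu> j a 0"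
    and conv_1: "gap_summable \<nu> j a 1"
  shows "\<exists>\<delta>\<^sub>0>0. \<forall>(chi :: real \<Rightarrow> real) (\<phi> :: real \<Rightarrow> real) (n :: nat)
           (g\<^sub>0 :: real \<Rightarrow> real) (g\<^sub>1 :: real \<Rightarrow> real) (g\<^sub>2 :: real \<Rightarrow> real).
     weight_function chi \<longrightarrow> \<phi> = weight_transform chi \<longrightarrow> 1 \<le> n \<longrightarrow>
     bounded (range g\<^sub>0) \<longrightarrow> bounded (range g\<^sub>1) \<longrightarrow> bounded (range g\<^sub>2) \<longrightarrow>
     (\<lambda>x. \<phi> x - g\<^sub>0 x / x ^ n) \<in> o[at_infinity](\<lambda>x. 1 / x ^ n) \<longrightarrow>
     (\<lambda>x. deriv \<phi> x - g\<^sub>1 x / x ^ n) \<in> o[at_infinity](\<lambda>x. 1 / x ^ n) \<longrightarrow>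
     (\<lambda>x. deriv (deriv \<phi>) x - g\<^sub>2 x / x ^ n) \<in> o[at_infinity](\<lambda>x. 1 / x ^ n) \<longrightarrow>
     gap_summable \<nu> j a n \<longrightarrow>
     (\<forall>\<delta> (\<nu>T :: real \<Rightarrow> real). 0 < \<delta> \<longrightarrow> \<delta> \<le> \<delta>\<^sub>0 \<longrightarrow>
        (\<forall>T>0. frequency_map_approx chi (quasiperiodic \<nu> j a) (\<nu> $ j) \<delta> T (\<nu>T T)) \<longrightarrow>
        (\<lambda>T. (\<nu> $ j - \<nu>T T) -
             (- 1 / (T * deriv (deriv \<phi>) 0) *
                (\<Sum>\<^sub>\<infinity>k\<in>other_indices j. Re (a k) * deriv \<phi> (freq_gap \<nu> j k * T))))
          \<in> O[at_top](\<lambda>T. 1 / T ^ (2 * n + 1)))"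
proof -
  define S where "S = (\<Sum>\<^sub>\<infinity>k\<in>other_indices j. cmod (a k / of_real (freq_gap \<nu> j k ^ 1)))"
  have S: "0 \<le> S"
    unfolding S_def by (rule infsum_nonneg) simp
  \<comment> \<open>The choice makes \<open>2 \<delta>\<^sub>0 S\<close> at most \<open>1 / 4\<close>; the added 1 covers the case \<open>S = 0\<close>.\<close>
  define \<delta>\<^sub>0 where "\<delta>\<^sub>0 = 1 / (8 * (S + 1))"
  have "\<delta>\<^sub>0 > 0"
    using S by (simp add: \<delta>\<^sub>0_def)
  show ?thesis
  proof (rule exI[of _ \<delta>\<^sub>0], intro conjI allI impI)
    show "\<delta>\<^sub>0 > 0"
      by fact
    fix chi \<phi> :: "real \<Rightarrow> real" and n :: nat and g\<^sub>0 g\<^sub>1 g\<^sub>2 \<nu>T :: "real \<Rightarrow> real" and \<delta> :: real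
    assume chi: "weight_function chi" and \<phi>: "\<phi> = weight_transform chi" and n: "1 \<le> n"
      and g: "bounded (range g\<^sub>0)" "bounded (range g\<^sub>1)" "bounded (range g\<^sub>2)"
      and small: "(\<lambda>x. \<phi> x - g\<^sub>0 x / x ^ n) \<in> o[at_infinity](\<lambda>x. 1 / x ^ n)"
        "(\<lambda>x. deriv \<phi> x - g\<^sub>1 x / x ^ n) \<in> o[at_infinity](\<lambda>x. 1 / x ^ n)"
        "(\<lambda>x. deriv (deriv \<phi>) x - g\<^sub>2 x / x ^ n) \<in> o[at_infinity](\<lambda>x. 1 / x ^ n)"
      and conv_n: "gap_summable \<nu> j a n"
      and \<delta>: "0 < \<delta>" "\<delta> \<le> \<delta>\<^sub>0"
      and max: "\<forall>T>0. frequency_map_approx chi (quasiperiodic \<nu> j a) (\<nu> $ j) \<delta> T (\<nu>T T)"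
    interpret weight chi
      by unfold_locales (rule chi)
    have phi: "\<phi> = phi"
      by (simp add: \<phi> weight_transform_eq_phi)
    note derivs = phi deriv_phi deriv_phi'
    obtain C\<^sub>0 where C0: "\<And>x. \<bar>phi x\<bar> * \<bar>x\<bar> ^ n \<le> C\<^sub>0"
      using decay_bound_from_asymptotics[OF abs_phi_le_1 g(1) small(1)[unfolded derivs]] by blast
    obtain C\<^sub>1 where C1: "\<And>x. \<bar>phi' x\<bar> * \<bar>x\<bar> ^ n \<le> C\<^sub>1"
      using decay_bound_from_asymptotics[OF abs_phi'_le_1 g(2) small(2)[unfolded derivs]] by blast
    obtain C\<^sub>2 where C2: "\<And>x. \<bar>phi'' x\<bar> * \<bar>x\<bar> ^ n \<le> C\<^sub>2"
      using decay_bound_from_asymptotics[OF abs_phi''_le_1 g(3) small(3)[unfolded derivs]] by blast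
    interpret perturbed_weight chi "other_indices j" a "freq_gap \<nu> j" n "max C\<^sub>0 (max C\<^sub>1 C\<^sub>2)"
    proof unfold_locales
      show "\<bar>phi x\<bar> * \<bar>x\<bar> ^ n \<le> max C\<^sub>0 (max C\<^sub>1 C\<^sub>2)" "\<bar>phi' x\<bar> * \<bar>x\<bar> ^ n \<le> max C\<^sub>0 (max C\<^sub>1 C\<^sub>2)"
        "\<bar>phi'' x\<bar> * \<bar>x\<bar> ^ n \<le> max C\<^sub>0 (max C\<^sub>1 C\<^sub>2)" for x
        using C0[of x] C1[of x] C2[of x] by linarith+
    qed (use gap_nz conv_0 conv_1 conv_n n in \<open>simp_all add: gap_summable_def\<close>)
    have profile: "weighted_inner chi T (quasiperiodic \<nu> j a) (\<lambda>t. cis (\<sigma> * t)) = profile T ((\<sigma> - \<nu> $ j) * T)"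
      if "T > 0" for T \<sigma>
    proof -
      have "phi ((\<nu> $ j - \<sigma>) * T) = phi ((\<sigma> - \<nu> $ j) * T)"
        using phi_even[of "(\<sigma> - \<nu> $ j) * T"] by (simp add: algebra_simps)
      moreover have "(freq \<nu> k - \<sigma>) * T = freq_gap \<nu> j k * T - (\<sigma> - \<nu> $ j) * T" for k
        by (simp add: freq_gap_def algebra_simps)
      ultimately show ?thesis
        using weighted_inner_exponential_sum[OF summable_0 that, of "\<nu> $ j" "freq \<nu>" \<sigma>]
        by (simp add: quasiperiodic_def[abs_def] profile_def noise_def)
    qed
    \<comment> \<open>The offset of the approximation in units of \<open>1 / T\<close>; it maximises the profile on \<open>\<bar>y\<bar> \<le> \<delta> T\<close>.\<close>
    define x where "x T = (\<nu>T T - \<nu> $ j) * T" for T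
    have x_bound: "\<bar>x T\<bar> \<le> \<delta> * T" if "T > 0" for T
      using max that by (auto simp: x_def frequency_map_approx_def is_arg_max_def abs_mult abs_le_iff)
    have x_max: "cmod (profile T y) \<le> cmod (profile T (x T))" if "T > 0" "\<bar>y\<bar> \<le> \<delta> * T" for T y
    proof -
      have "\<bar>y / T\<bar> \<le> \<delta>"
        using that by (simp add: pos_divide_le_eq)
      then have "\<nu> $ j + y / T \<in> {\<nu> $ j - \<delta>..\<nu> $ j + \<delta>}"
        unfolding atLeastAtMost_iff by linarith
      moreover have "is_arg_max (\<lambda>\<sigma>. cmod (profile T ((\<sigma> - \<nu> $ j) * T)))
          (\<lambda>\<sigma>. \<sigma> \<in> {\<nu> $ j - \<delta>..\<nu> $ j + \<delta>}) (\<nu>T T)"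
        using max[rule_format, OF that(1)]
        unfolding frequency_map_approx_def profile[OF that(1)] .
      ultimately have "cmod (profile T ((\<nu> $ j + y / T - \<nu> $ j) * T)) \<le> cmod (profile T (x T))"
        unfolding is_arg_max_linorder x_def by blast
      then show ?thesis
        using that(1) by simp
    qed
    have "8 * \<delta> * gap_sum 1 \<le> 8 * \<delta>\<^sub>0 * S"
      using \<delta> S by (simp add: gap_sum_def S_def mult_right_mono)
    also have "\<dots> \<le> 1"
      using S by (simp add: \<delta>\<^sub>0_def field_simps)
    finally have near: "\<forall>\<^sub>F T in at_top. \<forall>x. \<bar>x\<bar> \<le> \<delta> * T \<longrightarrow>
        cmod (profile T 0) \<le> cmod (profile T x) \<longrightarrow> \<bar>x\<bar> < 1"
      using \<delta>(1) by (intro eventually_maximum_near_0) auto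
    obtain D where D: "\<forall>\<^sub>F T in at_top. \<forall>x. \<bar>x\<bar> < 1 \<longrightarrow>
        (phi' x - Re (noise' T x)) * (phi x + Re (noise T x)) = Im (noise' T x) * Im (noise T x) \<longrightarrow>
        \<bar>phi'' 0 * x - Re (noise' T 0)\<bar> \<le> D / T ^ (2 * n)"
      using critical_point_expansion by blast
    have main: "\<forall>\<^sub>F T in at_top. norm ((\<nu> $ j - \<nu>T T) - (- 1 / (T * phi'' 0) *
        (\<Sum>\<^sub>\<infinity>k\<in>other_indices j. Re (a k) * phi' (freq_gap \<nu> j k * T)))) \<le>
        D / \<bar>phi'' 0\<bar> * norm (1 / T ^ (2 * n + 1))"
      using near D eventually_gt_at_top[of "1 / \<delta>"] eventually_gt_at_top[of 0]
    proof eventually_elim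
      case (elim T)
      then have "T > 0"
        by simp
      have "1 < \<delta> * T"
        using elim(3) \<delta>(1) by (simp add: field_simps)
      have "\<bar>x T\<bar> < 1"
        using elim(1) x_bound[OF \<open>T > 0\<close>] x_max[OF \<open>T > 0\<close>, of 0] \<delta>(1) \<open>T > 0\<close> by simp
      moreover have "(phi' (x T) - Re (noise' T (x T))) * (phi (x T) + Re (noise T (x T))) =
          Im (noise' T (x T)) * Im (noise T (x T))"
      proof (rule critical_point_equation)
        \<comment> \<open>Once \<open>\<delta> T > 1\<close>, the maximum lies in the interior of the admissible interval.\<close>
        show "0 < \<delta> * T - \<bar>x T\<bar>"
          using \<open>\<bar>x T\<bar> < 1\<close> \<open>1 < \<delta> * T\<close> by simp
        show "cmod (profile T y) \<le> cmod (profile T (x T))" if "\<bar>y - x T\<bar> < \<delta> * T - \<bar>x T\<bar>" for y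
          using that by (intro x_max \<open>T > 0\<close>) linarith
      qed
      ultimately have *: "\<bar>phi'' 0 * x T - Re (noise' T 0)\<bar> \<le> D / T ^ (2 * n)"
        using elim(2) by blast
      have "(\<Sum>\<^sub>\<infinity>k\<in>other_indices j. Re (a k) * phi' (freq_gap \<nu> j k * T)) = Re (noise' T 0)"
        using infsum_Re[OF summable_bounded_coeff, of "\<lambda>k. phi' (freq_gap \<nu> j k * T)"] abs_phi'_le_1
        by (simp add: noise'_def)
      then have "(\<nu> $ j - \<nu>T T) - (- 1 / (T * phi'' 0) *
          (\<Sum>\<^sub>\<infinity>k\<in>other_indices j. Re (a k) * phi' (freq_gap \<nu> j k * T)))
          = - (phi'' 0 * x T - Re (noise' T 0)) / (T * phi'' 0)"
        using \<open>T > 0\<close> phi''_0_neg by (simp add: x_def field_simps)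
      also have "norm \<dots> = \<bar>phi'' 0 * x T - Re (noise' T 0)\<bar> / (T * \<bar>phi'' 0\<bar>)"
        using \<open>T > 0\<close> by (simp add: abs_mult abs_minus_commute)
      also have "\<dots> \<le> D / T ^ (2 * n) / (T * \<bar>phi'' 0\<bar>)"
        using * \<open>T > 0\<close> by (intro divide_right_mono) auto
      also have "\<dots> = D / \<bar>phi'' 0\<bar> * norm (1 / T ^ (2 * n + 1))"
        using \<open>T > 0\<close> by (simp add: mult_ac)
      finally show ?case .
    qed
    then show "(\<lambda>T. (\<nu> $ j - \<nu>T T) - (- 1 / (T * deriv (deriv \<phi>) 0) *
        (\<Sum>\<^sub>\<infinity>k\<in>other_indices j. Re (a k) * deriv \<phi> (freq_gap \<nu> j k * T))))
        \<in> O[at_top](\<lambda>T. 1 / T ^ (2 * n + 1))"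
      unfolding derivs by (rule bigoI)
  qed
qed

end
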